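(* Let $n, k$ be positive integers with $1 < k < n$ and $k - (k \bmod 2) \geq 2\sqrt{n}$. Then there exists an $(n,k)$-selection mechanism that is impartial and $\alpha$-optimal with $$\alpha = \frac{k-(k\bmod 2)}{k\left\lceil \frac{2n}{k-(k\bmod 2)} \right\rceil}.$$
   Context: Write $[n]=\{1,\ldots,n\}$, and let $\mathcal{A}_n$ be the set of $n\times n$ real matrices with non-negative entries and zero diagonal; $A_{ij}$ is the weight of the vote agent $i$ casts for agent $j$. For $A\in\mathcal{A}_n$, $A_{-i}$ denotes the matrix obtained from $A$ by removing its $i$-th row. For $S\subseteq[n]$ let $\sigma(S;A)=\sum_{i\in[n],\,j\in S}A_{ij}$, and let $\mathrm{OPT}_k(A)$ be an arbitrary set maximizing $\sigma(S;A)$ among all $S\subseteq[n]$ with $|S|=k$. An $(n,k)$-selection mechanism is a (deterministic) function $f\colon\mathcal{A}_n\to 2^{[n]}$ with $|f(A)|\le k$ for every $A\in\mathcal{A}_n$. It is impartial if for all $A,A'\in\mathcal{A}_n$ and all $i\in[n]$ with $A_{-i}=A'_{-i}$ we have $f(A)\cap\{i\}=f(A')\cap\{i\}$. For $\alpha\in[0,1]$, it is $\alpha$-optimal if $\sigma(f(A);A)\ge\alpha\cdot\sigma(\mathrm{OPT}_k(A);A)$ for all $A\in\mathcal{A}_n$. *)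

theory Defs
  imports Complex_Main "HOL-Library.FuncSet"
begin

text \<open>
  The index set \<open>[n]\<close> is \<open>{1..n}\<close>, and an \<open>n \<times> n\<close> matrix is an extensional function from row
  indices to rows, which are themselves extensional functions from column indices to entries.
  Equality of two elements of \<open>vote_matrices n\<close> is therefore equality of all \<open>n \<times> n\<close> entries.
\<close>

definition vote_matrices :: "nat \<Rightarrow> (nat \<Rightarrow> nat \<Rightarrow> real) set" where
  "vote_matrices n =
     {A \<in> {1..n} \<rightarrow>\<^sub>E ({1..n} \<rightarrow>\<^sub>E {0..}). \<forall>i\<in>{1..n}. A i i = 0}"

text \<open>The remaining rows keep their original indices.\<close>

definition remove_row :: "nat \<Rightarrow> nat \<Rightarrow> (nat \<Rightarrow> nat \<Rightarrow> real) \<Rightarrow> nat \<Rightarrow> nat \<Rightarrow> real" where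
  "remove_row n i A = restrict A ({1..n} - {i})"

definition score :: "nat \<Rightarrow> nat set \<Rightarrow> (nat \<Rightarrow> nat \<Rightarrow> real) \<Rightarrow> real" where
  "score n S A = (\<Sum>i\<in>{1..n}. \<Sum>j\<in>S. A i j)"

text \<open>For \<open>k \<le> n\<close> a maximizer exists, and \<^const>\<open>arg_max\<close> picks an arbitrary one.\<close>

definition OPT :: "nat \<Rightarrow> nat \<Rightarrow> (nat \<Rightarrow> nat \<Rightarrow> real) \<Rightarrow> nat set" where
  "OPT n k A = (ARG_MAX (\<lambda>S. score n S A) S. S \<subseteq> {1..n} \<and> card S = k)"

text \<open>
  Mechanisms are total functions in HOL; only their values on \<open>vote_matrices n\<close> are constrained.
\<close>

definition selection_mechanism ::
    "nat \<Rightarrow> nat \<Rightarrow> ((nat \<Rightarrow> nat \<Rightarrow> real) \<Rightarrow> nat set) \<Rightarrow> bool" where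
  "selection_mechanism n k f \<longleftrightarrow>
     f \<in> vote_matrices n \<rightarrow> Pow {1..n} \<and> (\<forall>A\<in>vote_matrices n. card (f A) \<le> k)"

definition impartial :: "nat \<Rightarrow> ((nat \<Rightarrow> nat \<Rightarrow> real) \<Rightarrow> nat set) \<Rightarrow> bool" where
  "impartial n f \<longleftrightarrow>
     (\<forall>A\<in>vote_matrices n. \<forall>A'\<in>vote_matrices n. \<forall>i\<in>{1..n}.
        remove_row n i A = remove_row n i A' \<longrightarrow> f A \<inter> {i} = f A' \<inter> {i})"

definition alpha_optimal ::
    "nat \<Rightarrow> nat \<Rightarrow> real \<Rightarrow> ((nat \<Rightarrow> nat \<Rightarrow> real) \<Rightarrow> nat set) \<Rightarrow> bool" where
  "alpha_optimal n k \<alpha> f \<longleftrightarrow>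
     \<alpha> \<in> {0..1} \<and>
     (\<forall>A\<in>vote_matrices n. score n (f A) A \<ge> \<alpha> * score n (OPT n k A) A)"

end

theory Submission
  imports Defs
begin

text \<open>
  Put \<open>p = (k - k mod 2) / 2\<close> and \<open>m = \<lceil>n / p\<rceil>\<close>, so that \<open>m \<le> p\<close> because \<open>n \<le> p\<^sup>2\<close>. The agents fit
  into a \<open>p \<times> m\<close> grid, which we partition in two ways into at most \<open>p\<close> groups of size at most \<open>m\<close>:
  by rows and by cyclic diagonals. Two distinct agents never share both their row and their
  diagonal, so every vote crosses groups in at least one of the partitions. Charge it to the rows if
  it crosses rows and to the diagonals otherwise. Selecting from each group of each partition an
  agent of maximal charged weight is impartial, since no vote charged to a partition stays inside a
  group. It selects at most \<open>2p \<le> k\<close> agents, and as every maximum is at least the average, these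
  receive at least the fraction \<open>1 / m\<close> of the total weight of all votes.
\<close>

section \<open>Group maximizers with a fixed tie-break\<close>

definition winners :: "'a::linorder set \<Rightarrow> ('a \<Rightarrow> 'b) \<Rightarrow> ('a \<Rightarrow> real) \<Rightarrow> 'a set" where
  "winners N g w = {j \<in> N. \<forall>x\<in>N. g x = g j \<longrightarrow> w x \<le> w j \<and> (w x = w j \<longrightarrow> j \<le> x)}"

lemma winners_subset: "winners N g w \<subseteq> N"
  by (auto simp: winners_def)

text \<open>Two winners of one group have equal weight, and the tie-break towards the smaller
  element then identifies them. So a partition contributes at most one agent per group.\<close>

lemma inj_on_winners: "inj_on g (winners N g w)"
proof (rule inj_onI)
  fix x y assume "x \<in> winners N g w" "y \<in> winners N g w" "g x = g y"
  then have "w x \<le> w y" "w y \<le> w x" "w x = w y \<longrightarrow> x \<le> y" "w y = w x \<longrightarrow> y \<le> x"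
    unfolding winners_def by auto
  then show "x = y" by force
qed

lemma winner_exists:
  assumes "finite N" and "x \<in> N"
  shows "\<exists>j\<in>winners N g w. g j = g x"
proof -
  define G where "G = {y \<in> N. g y = g x}"
  have G: "finite G" "G \<noteq> {}" using assms by (auto simp: G_def)
  define M where "M = {y \<in> G. w y = Max (w ` G)}"
  have "Max (w ` G) \<in> w ` G" using G by (intro Max_in) auto
  then obtain y where "y \<in> G" "Max (w ` G) = w y" by auto
  then have M: "finite M" "M \<noteq> {}" using G by (auto simp: M_def)
  then have "Min M \<in> M" by (rule Min_in)
  moreover have "w y \<le> Max (w ` G)" if "y \<in> G" for y using that G by auto
  moreover have "Min M \<le> y" if "y \<in> M" for y using that M by auto
  ultimately have "Min M \<in> winners N g w" "g (Min M) = g x"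
    by (auto simp: winners_def M_def G_def)
  then show ?thesis by blast
qed

lemma image_winners:
  assumes "finite N"
  shows "g ` winners N g w = g ` N"
proof
  show "g ` winners N g w \<subseteq> g ` N" by (intro image_mono winners_subset)
  show "g ` N \<subseteq> g ` winners N g w"
    using winner_exists[OF assms, of _ g w] by (metis image_subsetI imageI)
qed

lemma card_winners_le:
  assumes "finite C" and "g ` N \<subseteq> C"
  shows "card (winners N g w) \<le> card C"
proof (rule card_inj_on_le[OF inj_on_winners _ \<open>finite C\<close>])
  show "g ` winners N g w \<subseteq> C" using assms(2) winners_subset[of N g w] by blast
qed

text \<open>A group has at most \<open>m\<close> members, none heavier than its winner;
  nonnegativity allows the group size to be replaced by \<open>m\<close>.\<close>

lemma sum_le_sum_winners:
  fixes w :: "'a::linorder \<Rightarrow> real"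
  assumes "finite N" and nonneg: "\<And>x. x \<in> N \<Longrightarrow> 0 \<le> w x"
    and fibers: "\<And>c. card {x \<in> N. g x = c} \<le> m"
  shows "sum w N \<le> real m * sum w (winners N g w)"
proof -
  have "sum w N = (\<Sum>c\<in>g ` N. \<Sum>x | x \<in> N \<and> g x = c. w x)"
    by (rule sum.image_gen[OF \<open>finite N\<close>])
  \<comment> \<open>\<open>g\<close> maps the winners bijectively onto the group labels, so the sum
    over groups becomes a sum over winners.\<close>
  also have "\<dots> = (\<Sum>j\<in>winners N g w. \<Sum>x | x \<in> N \<and> g x = g j. w x)"
    using sum.reindex[OF inj_on_winners[of g N w], of "\<lambda>c. \<Sum>x | x \<in> N \<and> g x = c. w x"]
    by (simp add: image_winners[OF \<open>finite N\<close>])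
  also have "\<dots> \<le> (\<Sum>j\<in>winners N g w. real m * w j)"
  proof (rule sum_mono)
    fix j assume j: "j \<in> winners N g w"
    have "(\<Sum>x | x \<in> N \<and> g x = g j. w x) \<le> real (card {x \<in> N. g x = g j}) * w j"
      using j by (intro sum_bounded_above) (auto simp: winners_def)
    also have "\<dots> \<le> real m * w j"
      using j fibers nonneg winners_subset[of N g w] by (intro mult_right_mono) auto
    finally show "(\<Sum>x | x \<in> N \<and> g x = g j. w x) \<le> real m * w j" .
  qed
  finally show ?thesis by (simp add: sum_distrib_left)
qed

text \<open>Winning is decided inside the group of \<open>i\<close> alone; impartiality rests on
  this locality.\<close>

lemma winners_mem_cong:
  assumes "\<And>x. x \<in> N \<Longrightarrow> g x = g i \<Longrightarrow> w x = w' x"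
  shows "i \<in> winners N g w \<longleftrightarrow> i \<in> winners N g w'"
  using assms by (auto simp: winners_def)

section \<open>The mechanism built from two partitions\<close>

definition first_weight :: "nat \<Rightarrow> (nat \<Rightarrow> 'b) \<Rightarrow> (nat \<Rightarrow> nat \<Rightarrow> real) \<Rightarrow> nat \<Rightarrow> real" where
  "first_weight n g A j = (\<Sum>i | i \<in> {1..n} \<and> g i \<noteq> g j. A i j)"

definition second_weight ::
    "nat \<Rightarrow> (nat \<Rightarrow> 'b) \<Rightarrow> (nat \<Rightarrow> 'c) \<Rightarrow> (nat \<Rightarrow> nat \<Rightarrow> real) \<Rightarrow> nat \<Rightarrow> real" where
  "second_weight n g h A j = (\<Sum>i | i \<in> {1..n} \<and> g i = g j \<and> h i \<noteq> h j. A i j)"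

definition two_partition_mechanism ::
    "nat \<Rightarrow> (nat \<Rightarrow> 'b) \<Rightarrow> (nat \<Rightarrow> 'c) \<Rightarrow> (nat \<Rightarrow> nat \<Rightarrow> real) \<Rightarrow> nat set" where
  "two_partition_mechanism n g h A =
     winners {1..n} g (first_weight n g A) \<union> winners {1..n} h (second_weight n g h A)"

lemma two_partition_mechanism_subset: "two_partition_mechanism n g h A \<subseteq> {1..n}"
  unfolding two_partition_mechanism_def by (intro Un_least winners_subset)

lemma vote_matrices_nonneg:
  "A \<in> vote_matrices n \<Longrightarrow> i \<in> {1..n} \<Longrightarrow> j \<in> {1..n} \<Longrightarrow> 0 \<le> A i j"
  by (simp add: vote_matrices_def PiE_iff)

text \<open>Row \<open>i\<close> enters neither \<open>first_weight\<close> of agents in the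
  \<open>g\<close>-group of \<open>i\<close> nor \<open>second_weight\<close> of agents in its
  \<open>h\<close>-group, so changing it leaves every weight that \<open>i\<close> competes with
  unchanged.\<close>

lemma impartial_two_partition_mechanism: "impartial n (two_partition_mechanism n g h)"
  unfolding impartial_def
proof (intro ballI impI)
  fix A A' i assume "remove_row n i A = remove_row n i A'"
  then have eq: "A l = A' l" if "l \<in> {1..n}" "l \<noteq> i" for l
    using that by (auto simp: remove_row_def restrict_def fun_eq_iff split: if_splits)
  have "first_weight n g A x = first_weight n g A' x" if "g x = g i" for x
    unfolding first_weight_def using that by (intro sum.cong refl eq[THEN fun_cong]) auto
  moreover have "second_weight n g h A x = second_weight n g h A' x" if "h x = h i" for x
    unfolding second_weight_def using that by (intro sum.cong refl eq[THEN fun_cong]) auto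
  ultimately have "i \<in> two_partition_mechanism n g h A \<longleftrightarrow> i \<in> two_partition_mechanism n g h A'"
    unfolding two_partition_mechanism_def Un_iff
    by (intro arg_cong2[where f = "(\<or>)"] winners_mem_cong)
  then show "two_partition_mechanism n g h A \<inter> {i} = two_partition_mechanism n g h A' \<inter> {i}"
    by blast
qed

text \<open>A vote missed by both weights has its voter and its target in the same
  \<open>g\<close>-group and the same \<open>h\<close>-group. Injectivity makes them equal, and the
  diagonal is zero.\<close>

lemma column_sum_split:
  assumes A: "A \<in> vote_matrices n" and "j \<in> {1..n}"
    and inj: "inj_on (\<lambda>i. (g i, h i)) {1..n}"
  shows "(\<Sum>i\<in>{1..n}. A i j) = first_weight n g A j + second_weight n g h A j"
proof -
  have "(\<Sum>i\<in>{1..n}. A i j) =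
      (\<Sum>i | i \<in> {1..n} \<and> g i \<noteq> g j. A i j) + (\<Sum>i | i \<in> {1..n} \<and> g i = g j. A i j)"
    by (subst sum.union_disjoint[symmetric]) (auto intro!: sum.cong)
  also have "(\<Sum>i | i \<in> {1..n} \<and> g i = g j. A i j) =
      (\<Sum>i | i \<in> {1..n} \<and> g i = g j \<and> h i \<noteq> h j. A i j)"
  proof (rule sum.mono_neutral_right)
    show "\<forall>i\<in>{i \<in> {1..n}. g i = g j} - {i \<in> {1..n}. g i = g j \<and> h i \<noteq> h j}. A i j = 0"
      using A \<open>j \<in> {1..n}\<close> inj by (auto simp: vote_matrices_def dest: inj_onD)
  qed auto
  finally show ?thesis by (simp add: first_weight_def second_weight_def)
qed

lemma score_two_partition_mechanism:
  assumes A: "A \<in> vote_matrices n"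
    and inj: "inj_on (\<lambda>i. (g i, h i)) {1..n}"
    and fibers: "\<And>c. card {i \<in> {1..n}. g i = c} \<le> m" "\<And>c. card {i \<in> {1..n}. h i = c} \<le> m"
  shows "score n {1..n} A \<le> real m * score n (two_partition_mechanism n g h A) A"
proof -
  let ?u = "first_weight n g A" and ?v = "second_weight n g h A"
  let ?U = "winners {1..n} g ?u" and ?V = "winners {1..n} h ?v"
  let ?F = "two_partition_mechanism n g h A"
  have score: "score n S A = sum ?u S + sum ?v S" if "S \<subseteq> {1..n}" for S
  proof -
    have "score n S A = (\<Sum>j\<in>S. \<Sum>i\<in>{1..n}. A i j)"
      unfolding score_def by (rule sum.swap)
    also have "\<dots> = (\<Sum>j\<in>S. ?u j + ?v j)"
      using that column_sum_split[OF A _ inj] by (intro sum.cong) auto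
    finally show ?thesis by (simp add: sum.distrib)
  qed
  have nonneg: "0 \<le> ?u j" "0 \<le> ?v j" if "j \<in> {1..n}" for j
    unfolding first_weight_def second_weight_def
    using that vote_matrices_nonneg[OF A] by (auto intro!: sum_nonneg)
  have F: "?F = ?U \<union> ?V" "?F \<subseteq> {1..n}"
    by (rule two_partition_mechanism_def two_partition_mechanism_subset)+
  then have "finite ?F" by (rule_tac finite_subset) auto
  \<comment> \<open>An agent in both \<open>?U\<close> and \<open>?V\<close> does no harm:
    \<open>?u\<close> and \<open>?v\<close> are disjoint parts of its column sum.\<close>
  then have "sum ?u ?U \<le> sum ?u ?F" "sum ?v ?V \<le> sum ?v ?F"
    using F nonneg by (auto intro!: sum_mono2)
  then have "real m * (sum ?u ?U + sum ?v ?V) \<le> real m * score n ?F A"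
    unfolding score[OF F(2)] by (intro mult_left_mono add_mono) auto
  moreover have "sum ?u {1..n} \<le> real m * sum ?u ?U" "sum ?v {1..n} \<le> real m * sum ?v ?V"
    using nonneg fibers by (auto intro!: sum_le_sum_winners)
  ultimately show ?thesis
    by (simp add: score distrib_left)
qed

section \<open>Bounding the optimum by the total score\<close>

lemma OPT_subset:
  assumes "k \<le> n"
  shows "OPT n k A \<subseteq> {1..n}"
proof -
  let ?C = "{S. S \<subseteq> {1..n} \<and> card S = k}"
  have "finite ?C" by (rule finite_subset[of _ "Pow {1..n}"]) auto
  moreover have "?C \<noteq> {}" using assms obtain_subset_with_card_n[of k "{1..n}"] by auto
  ultimately have "Max ((\<lambda>S. score n S A) ` ?C) \<in> (\<lambda>S. score n S A) ` ?C"
    by (intro Max_in) auto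
  then obtain S where S: "S \<in> ?C" "score n S A = Max ((\<lambda>S. score n S A) ` ?C)"
    by force
  \<comment> \<open>\<open>OPT\<close> is a Hilbert choice, so its properties follow only once some
    maximizer is exhibited.\<close>
  have "is_arg_max (\<lambda>S. score n S A) (\<lambda>S. S \<subseteq> {1..n} \<and> card S = k) S"
    using S \<open>finite ?C\<close> by (auto simp: is_arg_max_linorder intro!: Max_ge)
  then have "is_arg_max (\<lambda>S. score n S A) (\<lambda>S. S \<subseteq> {1..n} \<and> card S = k) (OPT n k A)"
    unfolding OPT_def arg_max_def by (rule someI)
  then show ?thesis by (simp add: is_arg_max_def)
qed

lemma score_mono:
  assumes "A \<in> vote_matrices n" and "S \<subseteq> T" and "T \<subseteq> {1..n}"
  shows "score n S A \<le> score n T A"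
  unfolding score_def
proof (intro sum_mono sum_mono2[OF _ \<open>S \<subseteq> T\<close>])
  show "finite T" using assms(3) by (rule finite_subset) simp
next
  fix i j assume "i \<in> {1..n}" "j \<in> T - S"
  then show "0 \<le> A i j" using assms by (intro vote_matrices_nonneg) auto
qed

section \<open>Rows and cyclic diagonals of the grid\<close>

definition grid_row :: "nat \<Rightarrow> nat \<Rightarrow> nat" where
  "grid_row m i = (i - 1) div m"

text \<open>Row index plus column index, wrapped around so that only \<open>p\<close> labels occur;
  \<open>i - 1\<close> makes both indices start at 0.\<close>

definition grid_diagonal :: "nat \<Rightarrow> nat \<Rightarrow> nat \<Rightarrow> nat" where
  "grid_diagonal p m i = ((i - 1) div m + (i - 1) mod m) mod p"

text \<open>A set of agents meeting each of the \<open>m\<close> grid columns at most once has at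
  most \<open>m\<close> members.\<close>

lemma card_le_of_inj_mod:
  assumes "0 < m" and "\<And>x y. x \<in> S \<Longrightarrow> y \<in> S \<Longrightarrow> (x - 1) mod m = (y - 1) mod m \<Longrightarrow> x = y"
  shows "card S \<le> (m::nat)"
proof -
  have "inj_on (\<lambda>x. (x - 1) mod m) S" using assms(2) by (rule inj_onI)
  then have "card S \<le> card {..<m}" using \<open>0 < m\<close> by (intro card_inj_on_le) auto
  then show ?thesis by simp
qed

lemma eq_of_div_mod_eq:
  fixes x y m :: nat
  assumes "1 \<le> x" "1 \<le> y" "(x - 1) div m = (y - 1) div m" "(x - 1) mod m = (y - 1) mod m"
  shows "x = y"
proof -
  have "x - 1 = (x - 1) div m * m + (x - 1) mod m" by simp
  also have "\<dots> = y - 1" unfolding assms(3,4) by simp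
  finally have "x - 1 = y - 1" .
  then show ?thesis using assms(1,2) by simp
qed

lemma card_grid_row_fiber:
  assumes "0 < m"
  shows "card {i \<in> {1..n}. grid_row m i = c} \<le> m"
proof (rule card_le_of_inj_mod[OF assms])
  fix x y
  assume "x \<in> {i \<in> {1..n}. grid_row m i = c}" "y \<in> {i \<in> {1..n}. grid_row m i = c}"
    and "(x - 1) mod m = (y - 1) mod m"
  then show "x = y" by (intro eq_of_div_mod_eq[of x y m]) (simp_all add: grid_row_def)
qed

lemma grid_row_less:
  assumes "n \<le> p * m" and "i \<in> {1..n}"
  shows "grid_row m i < p"
  using assms by (auto simp: grid_row_def intro!: less_mult_imp_div_less)

lemma mod_add_cancel_less:
  fixes a b c p :: nat
  assumes "(c + a) mod p = (c + b) mod p" "a < p" "b < p"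
  shows "a = b"
proof -
  have "int p dvd int a - int b"
    using assms(1) by (metis add_diff_cancel_left mod_eq_dvd_iff of_nat_add of_nat_mod)
  then show ?thesis using assms(2,3) zdvd_imp_le[of "int p" "\<bar>int a - int b\<bar>"] by force
qed

text \<open>Within a column the row indices are distinct and below \<open>p\<close>, so no diagonal
  meets a column twice.\<close>

lemma card_grid_diagonal_fiber:
  assumes "0 < m" and "n \<le> p * m"
  shows "card {i \<in> {1..n}. grid_diagonal p m i = c} \<le> m"
proof (rule card_le_of_inj_mod[OF \<open>0 < m\<close>])
  fix x y
  assume x: "x \<in> {i \<in> {1..n}. grid_diagonal p m i = c}"
    and y: "y \<in> {i \<in> {1..n}. grid_diagonal p m i = c}"
    and eq: "(x - 1) mod m = (y - 1) mod m"
  have "((y - 1) mod m + (x - 1) div m) mod p = ((y - 1) mod m + (y - 1) div m) mod p"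
    using x y eq by (simp add: grid_diagonal_def add.commute)
  moreover have "(x - 1) div m < p" "(y - 1) div m < p"
    using x y grid_row_less[OF assms(2)] by (auto simp: grid_row_def)
  ultimately have "(x - 1) div m = (y - 1) div m" by (rule mod_add_cancel_less)
  then show "x = y" using x y eq by (intro eq_of_div_mod_eq[of x y m]) auto
qed

text \<open>Within a row the column indices are below \<open>m \<le> p\<close>, so wrapping modulo
  \<open>p\<close> keeps their diagonals distinct.\<close>

lemma inj_on_grid:
  assumes "0 < m" and "m \<le> p"
  shows "inj_on (\<lambda>i. (grid_row m i, grid_diagonal p m i)) {1..n}"
proof (rule inj_onI)
  fix x y assume x: "x \<in> {1..n}" and y: "y \<in> {1..n}"
    and "(grid_row m x, grid_diagonal p m x) = (grid_row m y, grid_diagonal p m y)"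
  then have row: "(x - 1) div m = (y - 1) div m"
    and "((x - 1) div m + (x - 1) mod m) mod p = ((y - 1) div m + (y - 1) mod m) mod p"
    unfolding grid_row_def grid_diagonal_def prod.inject by blast+
  then have "((y - 1) div m + (x - 1) mod m) mod p = ((y - 1) div m + (y - 1) mod m) mod p"
    by simp
  moreover have "(x - 1) mod m < p" "(y - 1) mod m < p"
    using assms by (meson less_le_trans mod_less_divisor)+
  ultimately have "(x - 1) mod m = (y - 1) mod m" by (blast intro: mod_add_cancel_less)
  then show "x = y" using row x y by (intro eq_of_div_mod_eq[of x y m]) auto
qed

theorem theorem4p1:
  fixes n k :: nat
  assumes "1 < k" and "k < n"
    and "real (k - k mod 2) \<ge> 2 * sqrt (real n)"
  shows "\<exists>f. selection_mechanism n k f \<and> impartial n f \<and>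
           alpha_optimal n k
             (real (k - k mod 2) /
               (real k * of_int \<lceil>2 * real n / real (k - k mod 2)\<rceil>)) f"
proof -
  define p where "p = k div 2"
  have K: "k - k mod 2 = 2 * p" unfolding p_def by presburger
  have p: "0 < p" "2 * p \<le> k" using \<open>1 < k\<close> by (auto simp: p_def)
  define m where "m = nat \<lceil>real n / real p\<rceil>"
  have quot: "2 * real n / real (k - k mod 2) = real n / real p" unfolding K by simp
  have pos: "0 < real n / real p" using \<open>k < n\<close> p by simp
  then have m: "real m = of_int \<lceil>2 * real n / real (k - k mod 2)\<rceil>" "0 < m"
    unfolding quot m_def by (simp_all add: less_imp_le)
  have "real n / real p \<le> real m" unfolding m_def by linarith
  then have "real n \<le> real (p * m)" using p by (simp add: field_simps)
  then have npm: "n \<le> p * m" by linarith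
  \<comment> \<open>The lower bound on \<open>k\<close> gives \<open>n / p \<le> p\<close>; as
    \<open>p\<close> is an integer, the ceiling \<open>m\<close> obeys the same bound.\<close>
  have "sqrt (real n) \<le> real p" using assms(3) unfolding K by simp
  then have "real n \<le> (real p)\<^sup>2" by (rule sqrt_le_D)
  then have "real n / real p \<le> real p" using p by (simp add: field_simps power2_eq_square)
  then have "m \<le> p" unfolding m_def by (simp add: ceiling_le_iff nat_le_iff)
  define f where "f = two_partition_mechanism n (grid_row m) (grid_diagonal p m)"
  have f_subset: "f A \<subseteq> {1..n}" for A
    unfolding f_def by (rule two_partition_mechanism_subset)
  have card: "card (f A) \<le> k" for A
  proof -
    have "card (f A) \<le> card {..<p} + card {..<p}"
      unfolding f_def two_partition_mechanism_def
      using p grid_row_less[OF npm]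
      by (intro order_trans[OF card_Un_le] add_mono card_winners_le) (auto simp: grid_diagonal_def)
    then show ?thesis using p by simp
  qed
  \<comment> \<open>The mechanism secures \<open>1 / m\<close> of all votes, hence of the optimum.
    The claimed ratio equals \<open>1 / m\<close> for even \<open>k\<close> and is smaller for odd
    \<open>k\<close>.\<close>
  let ?\<alpha> = "real (2 * p) / (real k * real m)"
  have \<alpha>: "0 \<le> ?\<alpha>" "?\<alpha> \<le> 1 / real m"
    using p m(2) \<open>1 < k\<close> by (auto simp: field_simps)
  moreover have "1 / real m \<le> 1" using m(2) by simp
  ultimately have \<alpha>_01: "?\<alpha> \<in> {0..1}" by auto
  have optimal: "?\<alpha> * score n (OPT n k A) A \<le> score n (f A) A" if A: "A \<in> vote_matrices n" for A
  proof -
    have "0 \<le> score n {1..n} A"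
      unfolding score_def using vote_matrices_nonneg[OF A] by (intro sum_nonneg) auto
    moreover have "score n (OPT n k A) A \<le> score n {1..n} A"
      using score_mono[OF A OPT_subset] \<open>k < n\<close> by simp
    ultimately have "?\<alpha> * score n (OPT n k A) A \<le> 1 / real m * score n {1..n} A"
      using \<alpha> by (meson mult_left_mono mult_right_mono order_trans)
    also have "\<dots> \<le> score n (f A) A"
      using score_two_partition_mechanism[OF A inj_on_grid[OF m(2) \<open>m \<le> p\<close>]
          card_grid_row_fiber[OF m(2)] card_grid_diagonal_fiber[OF m(2) npm]] m(2)
      by (simp add: f_def field_simps)
    finally show ?thesis .
  qed
  have "selection_mechanism n k f"
    using f_subset card by (auto simp: selection_mechanism_def)
  moreover have "impartial n f"
    unfolding f_def by (rule impartial_two_partition_mechanism)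
  moreover have "alpha_optimal n k ?\<alpha> f"
    using \<alpha>_01 optimal by (simp add: alpha_optimal_def)
  ultimately show ?thesis
    \<comment> \<open>The ceiling is folded into \<open>m\<close> first, since \<open>K\<close>
      would also rewrite \<open>k - k mod 2\<close> inside it.\<close>
    unfolding m(1)[symmetric] unfolding K by blast
qed

end
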